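(* Let $L$ be a non-trivial bounded lattice, and let $D(L)$ be the bounded lattice obtained from $L$ by adding, for each pair $a<b$ in $L$ with $b$ not covering $a$, two new elements $l_{a,b},r_{a,b}$ between $a$ and $b$ (as defined in the context). Then the lattice $D(L)$ is simple, i.e. its only congruences are $\Delta_{D(L)}$ and $\nabla_{D(L)}$, and these are distinct.
   Context: Non-trivial means having at least two elements. $\prec$ denotes the cover relation of $L$. $\Delta_X$ is the equality relation on $X$ and $\nabla_X=X^2$. Definition of $D(L)$: let $(L,\leq,0,1)$ be a non-trivial bounded lattice. Its underlying set is the disjoint union of $L$ and $\{l_{a,b},r_{a,b}\mid a,b\in L,\ a<b,\ a\nprec b\}$, where all the elements $l_{a,b},r_{a,b}$ are new and pairwise distinct (one pair of new elements for each interval $[a,b]_L$ with at least three elements). The order $\leq$ on $D(L)$ extends that of $L$ as follows, where $m$ stands for either of $l_{a,b},r_{a,b}$ and $m'$ for either of $l_{c,d},r_{c,d}$: for $x\in L$, $x\leq m$ iff $x\leq a$ in $L$; for $y\in L$, $m\leq y$ iff $b\leq y$ in $L$; and $m\leq m'$ iff $m=m'$ or $b\leq c$ in $L$. This is a bounded lattice with bottom $0$ and top $1$; informally, each interval $I$ of $L$ with $|I|>2$ is replaced by its horizontal sum with the four-element Boolean lattice. *)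

theory Defs
  imports "HOL-Algebra.Lattice"
begin

definition covered_by :: "('a, 'b) gorder_scheme \<Rightarrow> 'a \<Rightarrow> 'a \<Rightarrow> bool" where
  "covered_by L a b \<longleftrightarrow> a \<in> carrier L \<and> b \<in> carrier L \<and> a \<sqsubset>\<^bsub>L\<^esub> b \<and>
     \<not> (\<exists>c \<in> carrier L. a \<sqsubset>\<^bsub>L\<^esub> c \<and> c \<sqsubset>\<^bsub>L\<^esub> b)"

datatype side = Lft | Rgt

text \<open>\<open>Old x\<close> is the element \<open>x\<close> of \<open>L\<close>; \<open>New Lft a b\<close> and \<open>New Rgt a b\<close> are the new elements
  $l_{a,b}$ and $r_{a,b}$. Only those listed in \<open>D_carrier\<close> belong to \<open>D L\<close>.\<close>

datatype 'a D_elem = Old 'a | New side 'a 'a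

definition D_carrier :: "('a, 'b) gorder_scheme \<Rightarrow> 'a D_elem set" where
  "D_carrier L = Old ` carrier L \<union>
     {New s a b | s a b. a \<in> carrier L \<and> b \<in> carrier L \<and> a \<sqsubset>\<^bsub>L\<^esub> b \<and> \<not> covered_by L a b}"

fun D_le :: "('a, 'b) gorder_scheme \<Rightarrow> 'a D_elem \<Rightarrow> 'a D_elem \<Rightarrow> bool" where
  "D_le L (Old x) (Old y) \<longleftrightarrow> x \<sqsubseteq>\<^bsub>L\<^esub> y"
| "D_le L (Old x) (New s a b) \<longleftrightarrow> x \<sqsubseteq>\<^bsub>L\<^esub> a"
| "D_le L (New s a b) (Old y) \<longleftrightarrow> b \<sqsubseteq>\<^bsub>L\<^esub> y"
| "D_le L (New s a b) (New t c d) \<longleftrightarrow> New s a b = New t c d \<or> b \<sqsubseteq>\<^bsub>L\<^esub> c"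

definition D :: "('a, 'b) gorder_scheme \<Rightarrow> 'a D_elem gorder" where
  "D L = \<lparr>carrier = D_carrier L, eq = (=), le = D_le L\<rparr>"

text \<open>The operations \<open>\<squnion>\<close> and \<open>\<sqinter>\<close> below are determined by the order, and are meaningful only
  when \<open>M\<close> is a lattice; hence the explicit conjunct in \<open>simple_lattice\<close>.\<close>

definition lattice_congruence :: "('a, 'b) gorder_scheme \<Rightarrow> 'a rel \<Rightarrow> bool" where
  "lattice_congruence M \<theta> \<longleftrightarrow> equiv (carrier M) \<theta> \<and>
     (\<forall>x x' y y'. (x, x') \<in> \<theta> \<longrightarrow> (y, y') \<in> \<theta> \<longrightarrow>
        (x \<squnion>\<^bsub>M\<^esub> y, x' \<squnion>\<^bsub>M\<^esub> y') \<in> \<theta> \<and> (x \<sqinter>\<^bsub>M\<^esub> y, x' \<sqinter>\<^bsub>M\<^esub> y') \<in> \<theta>)"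

definition simple_lattice :: "('a, 'b) gorder_scheme \<Rightarrow> bool" where
  "simple_lattice M \<longleftrightarrow> lattice M \<and>
     {\<theta>. lattice_congruence M \<theta>} = {Id_on (carrier M), carrier M \<times> carrier M} \<and>
     Id_on (carrier M) \<noteq> carrier M \<times> carrier M"

end

theory Submission
  imports Defs
begin

text \<open>
  Both halves of the theorem rest on a description of the order of \<open>D L\<close> in which old and new
  elements look alike. Give every element a lower and an upper end in \<open>L\<close>: an old element is both
  of its ends, and \<open>New s a b\<close> has ends \<open>a\<close> and \<open>b\<close>. Then \<open>x \<le> y\<close> in \<open>D L\<close> iff \<open>x = y\<close> or the
  upper end of \<open>x\<close> lies below the lower end of \<open>y\<close> (\<open>D_le_iff_ends\<close>). Hence the join of two
  incomparable elements is the old element at the join of their upper ends, and dually for meets,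
  so \<open>D L\<close> is a lattice with the bounds of \<open>L\<close>.

  For simplicity of \<open>D L\<close>, consider \<open>a < c < b\<close> in \<open>L\<close>. The interval of \<open>D L\<close> from \<open>a\<close> to \<open>b\<close>
  contains \<open>c\<close> and the two new elements \<open>l, r\<close> for \<open>[a, b]\<close>, and these three are pairwise
  complementary in it. If a congruence relates \<open>c\<close> to \<open>b\<close>, meeting with \<open>l\<close> and with \<open>r\<close> shows
  that \<open>l\<close> and \<open>r\<close> are both related to \<open>a\<close>, and then so is their join \<open>b\<close>. Dually, relating \<open>a\<close>
  to \<open>c\<close> relates \<open>a\<close> to \<open>b\<close> (\<open>congruence_D_descend\<close>, \<open>congruence_D_ascend\<close>). So from a related
  pair \<open>p < q\<close> of old elements one first moves the lower member down to \<open>\<bottom>\<close>, using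
  \<open>\<bottom> < p < q\<close>, and then the upper member up to \<open>\<top>\<close>, using \<open>\<bottom> < q < \<top>\<close>; by convexity everything
  is related. Finally, any nontrivial congruence does relate two distinct comparable old elements
  (\<open>congruence_D_Old_pair\<close>): a pair that involves \<open>l\<close> or \<open>r\<close> is transported to an old pair by
  joining or meeting with an element strictly inside \<open>[a, b]\<close>, which exists because \<open>b\<close> does not
  cover \<open>a\<close>.
\<close>

section \<open>The order on \<open>D L\<close>\<close>

fun lower_end :: "'a D_elem \<Rightarrow> 'a" where
  "lower_end (Old x) = x"
| "lower_end (New s a b) = a"

fun upper_end :: "'a D_elem \<Rightarrow> 'a" where
  "upper_end (Old x) = x"
| "upper_end (New s a b) = b"

lemma D_eq: "x .=\<^bsub>D L\<^esub> y \<longleftrightarrow> x = y"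
  by (simp add: D_def)

lemma Old_in_D [simp]: "Old x \<in> carrier (D L) \<longleftrightarrow> x \<in> carrier L"
  by (auto simp: D_def D_carrier_def)

context partial_order
begin

text \<open>The negated cover relation is replaced by a witness \<open>c\<close> strictly between \<open>a\<close> and \<open>b\<close>:
  this element is the tool of all later arguments about new elements.\<close>

lemma New_in_D:
  "New s a b \<in> carrier (D L) \<longleftrightarrow>
    a \<in> carrier L \<and> b \<in> carrier L \<and> (\<exists>c \<in> carrier L. a \<sqsubset> c \<and> c \<sqsubset> b)"
  by (auto simp: D_def D_carrier_def covered_by_def intro: lless_trans)

lemma ends_closed [simp]:
  assumes "x \<in> carrier (D L)"
  shows "lower_end x \<in> carrier L" "upper_end x \<in> carrier L"
  using assms by (cases x; simp add: New_in_D)+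

lemma New_ends_less: "New s a b \<in> carrier (D L) \<Longrightarrow> a \<sqsubset> b"
  by (auto simp: New_in_D intro: lless_trans)

lemma lower_end_le_upper_end [simp]:
  "x \<in> carrier (D L) \<Longrightarrow> lower_end x \<sqsubseteq> upper_end x"
  by (cases x) (use New_ends_less in \<open>simp_all add: lless_eq\<close>)

text \<open>The point behind antisymmetry: in a cycle \<open>x \<le> y \<le> x\<close> of distinct elements all four ends
  would coincide, which excludes new elements because their ends differ.\<close>

lemma ends_eq_imp_Old:
  "x \<in> carrier (D L) \<Longrightarrow> lower_end x = upper_end x \<Longrightarrow> x = Old (lower_end x)"
  by (cases x) (use New_ends_less in \<open>force simp: lless_eq\<close>)+

text \<open>Replaces the four cases in the definition of the order by a single one.\<close>

lemma D_le_iff_ends: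
  assumes "x \<in> carrier (D L)" "y \<in> carrier (D L)"
  shows "x \<sqsubseteq>\<^bsub>D L\<^esub> y \<longleftrightarrow> x = y \<or> upper_end x \<sqsubseteq> lower_end y"
  using assms by (cases x; cases y) (auto simp: D_def D_carrier_def)

lemma D_le_trans:
  assumes "x \<in> carrier (D L)" "y \<in> carrier (D L)" "z \<in> carrier (D L)"
    and "x \<sqsubseteq>\<^bsub>D L\<^esub> y" "y \<sqsubseteq>\<^bsub>D L\<^esub> z"
  shows "x \<sqsubseteq>\<^bsub>D L\<^esub> z"
proof (cases "x = y \<or> y = z")
  case True
  then show ?thesis using assms by auto
next
  case False
  then have "upper_end x \<sqsubseteq> lower_end y" "upper_end y \<sqsubseteq> lower_end z"
    using assms by (auto simp: D_le_iff_ends)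
  then have "upper_end x \<sqsubseteq> lower_end z"
    using assms(1-3) by (meson ends_closed le_trans lower_end_le_upper_end)
  then show ?thesis using assms by (simp add: D_le_iff_ends)
qed

lemma D_le_antisym:
  assumes "x \<in> carrier (D L)" "y \<in> carrier (D L)"
    and "x \<sqsubseteq>\<^bsub>D L\<^esub> y" "y \<sqsubseteq>\<^bsub>D L\<^esub> x"
  shows "x = y"
proof (rule ccontr)
  assume "x \<noteq> y"
  then have xy: "upper_end x \<sqsubseteq> lower_end y" "upper_end y \<sqsubseteq> lower_end x"
    using assms by (auto simp: D_le_iff_ends)
  have "lower_end x = upper_end x" "lower_end y = upper_end y" "lower_end x = lower_end y"
    using xy assms(1,2) by (meson ends_closed le_antisym le_trans lower_end_le_upper_end)+
  then show False
    using \<open>x \<noteq> y\<close> assms(1,2) ends_eq_imp_Old by metis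
qed

lemma partial_order_D: "partial_order (D L)"
proof
  show "(.=\<^bsub>D L\<^esub>) = (=)" by (simp add: D_def)
  show "x \<sqsubseteq>\<^bsub>D L\<^esub> x" if "x \<in> carrier (D L)" for x
    using that by (simp add: D_le_iff_ends)
  show "x \<sqsubseteq>\<^bsub>D L\<^esub> z" if "x \<sqsubseteq>\<^bsub>D L\<^esub> y" "y \<sqsubseteq>\<^bsub>D L\<^esub> z"
    "x \<in> carrier (D L)" "y \<in> carrier (D L)" "z \<in> carrier (D L)" for x y z
    using that D_le_trans by blast
  show "x .=\<^bsub>D L\<^esub> y" if "x \<sqsubseteq>\<^bsub>D L\<^esub> y" "y \<sqsubseteq>\<^bsub>D L\<^esub> x"
    "x \<in> carrier (D L)" "y \<in> carrier (D L)" for x y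
    using that D_le_antisym by (simp add: D_eq)
qed (simp_all add: D_eq)

end

section \<open>Joins and meets in \<open>D L\<close>\<close>

context lattice
begin

text \<open>An upper bound of two incomparable elements differs from both, hence lies above both upper
  ends, so only joins in \<open>L\<close> matter. In particular the join is always an old element.\<close>

lemma least_upper_incomparable:
  assumes D: "x \<in> carrier (D L)" "y \<in> carrier (D L)"
    and "\<not> x \<sqsubseteq>\<^bsub>D L\<^esub> y" "\<not> y \<sqsubseteq>\<^bsub>D L\<^esub> x"
  shows "least (D L) (Old (upper_end x \<squnion> upper_end y)) (Upper (D L) {x, y})"
proof (rule least_UpperI)
  fix u assume u: "u \<in> Upper (D L) {x, y}"
  then have uD: "u \<in> carrier (D L)" and "x \<sqsubseteq>\<^bsub>D L\<^esub> u" "y \<sqsubseteq>\<^bsub>D L\<^esub> u"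
    using D by (auto dest: Upper_memD)
  \<comment> \<open>If \<open>u\<close> were \<open>x\<close> or \<open>y\<close>, then \<open>x\<close> and \<open>y\<close> would be comparable.\<close>
  then have "upper_end x \<sqsubseteq> lower_end u" "upper_end y \<sqsubseteq> lower_end u"
    using assms D_le_iff_ends[of x u] D_le_iff_ends[of y u] by blast+
  then show "Old (upper_end x \<squnion> upper_end y) \<sqsubseteq>\<^bsub>D L\<^esub> u"
    using D uD by (simp add: D_le_iff_ends join_le)
qed (use D in \<open>auto simp: D_le_iff_ends join_left join_right\<close>)

lemma greatest_lower_incomparable:
  assumes D: "x \<in> carrier (D L)" "y \<in> carrier (D L)"
    and "\<not> x \<sqsubseteq>\<^bsub>D L\<^esub> y" "\<not> y \<sqsubseteq>\<^bsub>D L\<^esub> x"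
  shows "greatest (D L) (Old (lower_end x \<sqinter> lower_end y)) (Lower (D L) {x, y})"
proof (rule greatest_LowerI)
  fix u assume u: "u \<in> Lower (D L) {x, y}"
  then have uD: "u \<in> carrier (D L)" and "u \<sqsubseteq>\<^bsub>D L\<^esub> x" "u \<sqsubseteq>\<^bsub>D L\<^esub> y"
    using D by (auto dest: Lower_memD)
  then have "upper_end u \<sqsubseteq> lower_end x" "upper_end u \<sqsubseteq> lower_end y"
    using assms D_le_iff_ends[of u x] D_le_iff_ends[of u y] by blast+
  then show "u \<sqsubseteq>\<^bsub>D L\<^esub> Old (lower_end x \<sqinter> lower_end y)"
    using D uD by (simp add: D_le_iff_ends meet_le)
qed (use D in \<open>auto simp: D_le_iff_ends meet_left meet_right\<close>)

lemma lattice_D: "lattice (D L)"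
proof -
  interpret D: partial_order "D L" by (rule partial_order_D)
  show ?thesis
  proof
    fix x y assume D: "x \<in> carrier (D L)" "y \<in> carrier (D L)"
    show "\<exists>s. least (D L) s (Upper (D L) {x, y})"
    proof (cases "x \<sqsubseteq>\<^bsub>D L\<^esub> y \<or> y \<sqsubseteq>\<^bsub>D L\<^esub> x")
      case True
      then have "least (D L) y (Upper (D L) {x, y}) \<or> least (D L) x (Upper (D L) {x, y})"
        using D by (auto intro!: least_UpperI)
      then show ?thesis by blast
    qed (use D least_upper_incomparable in blast)
    show "\<exists>s. greatest (D L) s (Lower (D L) {x, y})"
    proof (cases "x \<sqsubseteq>\<^bsub>D L\<^esub> y \<or> y \<sqsubseteq>\<^bsub>D L\<^esub> x")
      case True
      then have "greatest (D L) x (Lower (D L) {x, y}) \<or> greatest (D L) y (Lower (D L) {x, y})"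
        using D by (auto intro!: greatest_LowerI)
      then show ?thesis by blast
    qed (use D greatest_lower_incomparable in blast)
  qed
qed

lemma D_join_incomparable:
  assumes "x \<in> carrier (D L)" "y \<in> carrier (D L)"
    and "\<not> x \<sqsubseteq>\<^bsub>D L\<^esub> y" "\<not> y \<sqsubseteq>\<^bsub>D L\<^esub> x"
  shows "x \<squnion>\<^bsub>D L\<^esub> y = Old (upper_end x \<squnion> upper_end y)"
proof -
  interpret D: lattice "D L" by (rule lattice_D)
  show ?thesis
    using D.least_unique[OF D.sup_of_two_least least_upper_incomparable] assms
    by (simp add: join_def)
qed

lemma D_meet_incomparable:
  assumes "x \<in> carrier (D L)" "y \<in> carrier (D L)"
    and "\<not> x \<sqsubseteq>\<^bsub>D L\<^esub> y" "\<not> y \<sqsubseteq>\<^bsub>D L\<^esub> x"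
  shows "x \<sqinter>\<^bsub>D L\<^esub> y = Old (lower_end x \<sqinter> lower_end y)"
proof -
  interpret D: lattice "D L" by (rule lattice_D)
  show ?thesis
    using D.greatest_unique[OF D.inf_of_two_greatest greatest_lower_incomparable] assms
    by (simp add: meet_def)
qed

lemma join_absorb: "x \<in> carrier L \<Longrightarrow> y \<in> carrier L \<Longrightarrow> x \<sqsubseteq> y \<Longrightarrow> x \<squnion> y = y"
  using weak_le_iff_meet by (simp add: eq_is_equal)

lemma meet_absorb: "x \<in> carrier L \<Longrightarrow> y \<in> carrier L \<Longrightarrow> x \<sqsubseteq> y \<Longrightarrow> x \<sqinter> y = x"
  using weak_le_iff_join[of x y] by (simp add: eq_is_equal)

text \<open>Together with the next lemma: the two new elements for \<open>[a, b]\<close> and any old element strictly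
  inside \<open>[a, b]\<close> are pairwise complementary in that interval. This is what makes congruences
  collapse.\<close>

lemma New_pair_complementary:
  assumes "New Lft a b \<in> carrier (D L)"
  shows "New Lft a b \<squnion>\<^bsub>D L\<^esub> New Rgt a b = Old b"
    and "New Lft a b \<sqinter>\<^bsub>D L\<^esub> New Rgt a b = Old a"
proof -
  have D: "New Rgt a b \<in> carrier (D L)" and ab: "a \<sqsubset> b" "a \<in> carrier L" "b \<in> carrier L"
    using assms New_ends_less[OF assms] by (simp_all add: New_in_D)
  then have "\<not> b \<sqsubseteq> a" using le_antisym by (auto simp: lless_eq)
  then have "\<not> New Lft a b \<sqsubseteq>\<^bsub>D L\<^esub> New Rgt a b" "\<not> New Rgt a b \<sqsubseteq>\<^bsub>D L\<^esub> New Lft a b"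
    using assms D by (auto simp: D_le_iff_ends)
  then show "New Lft a b \<squnion>\<^bsub>D L\<^esub> New Rgt a b = Old b" "New Lft a b \<sqinter>\<^bsub>D L\<^esub> New Rgt a b = Old a"
    using assms D ab
    by (simp_all add: D_join_incomparable D_meet_incomparable join_absorb meet_absorb)
qed

lemma New_inside_complementary:
  assumes c: "a \<in> carrier L" "b \<in> carrier L" "c \<in> carrier L" "a \<sqsubset> c" "c \<sqsubset> b"
  shows "New s a b \<squnion>\<^bsub>D L\<^esub> Old c = Old b"
    and "New s a b \<sqinter>\<^bsub>D L\<^esub> Old c = Old a"
proof -
  have D: "New s a b \<in> carrier (D L)" "Old c \<in> carrier (D L)"
    using c by (auto simp: New_in_D)
  have "\<not> b \<sqsubseteq> c" "\<not> c \<sqsubseteq> a" using c by (auto simp: lless_eq)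
  then have "\<not> New s a b \<sqsubseteq>\<^bsub>D L\<^esub> Old c" "\<not> Old c \<sqsubseteq>\<^bsub>D L\<^esub> New s a b"
    using D by (auto simp: D_le_iff_ends)
  then show "New s a b \<squnion>\<^bsub>D L\<^esub> Old c = Old b" "New s a b \<sqinter>\<^bsub>D L\<^esub> Old c = Old a"
    using c D by (simp_all add: D_join_incomparable D_meet_incomparable join_absorb meet_absorb
        join_comm[of L b c] lless_eq)
qed

section \<open>Congruences of a lattice\<close>

lemma congruenceD:
  assumes "lattice_congruence L \<theta>"
  shows congruence_closed: "(x, y) \<in> \<theta> \<Longrightarrow> x \<in> carrier L \<and> y \<in> carrier L"
    and congruence_refl: "x \<in> carrier L \<Longrightarrow> (x, x) \<in> \<theta>"
    and congruence_sym: "(x, y) \<in> \<theta> \<Longrightarrow> (y, x) \<in> \<theta>"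
    and congruence_trans: "(x, y) \<in> \<theta> \<Longrightarrow> (y, z) \<in> \<theta> \<Longrightarrow> (x, z) \<in> \<theta>"
    and congruence_join: "(x, y) \<in> \<theta> \<Longrightarrow> (x', y') \<in> \<theta> \<Longrightarrow> (x \<squnion> x', y \<squnion> y') \<in> \<theta>"
    and congruence_meet: "(x, y) \<in> \<theta> \<Longrightarrow> (x', y') \<in> \<theta> \<Longrightarrow> (x \<sqinter> x', y \<sqinter> y') \<in> \<theta>"
  using assms
  by (auto simp: lattice_congruence_def equiv_def refl_on_def dest: symD transD)

text \<open>The polynomial \<open>t \<mapsto> (t \<squnion> u) \<sqinter> v\<close> sends \<open>x\<close> to \<open>u\<close> and \<open>y\<close> to \<open>v\<close>.\<close>

lemma congruence_convex:
  assumes "lattice_congruence L \<theta>" "(x, y) \<in> \<theta>"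
    and "u \<in> carrier L" "v \<in> carrier L" "x \<sqsubseteq> u" "u \<sqsubseteq> v" "v \<sqsubseteq> y"
  shows "(u, v) \<in> \<theta>"
proof -
  note xy = congruence_closed[OF assms(1,2)]
  have "((x \<squnion> u) \<sqinter> v, (y \<squnion> u) \<sqinter> v) \<in> \<theta>"
    using assms by (intro congruence_join congruence_meet congruence_refl) auto
  moreover have "(x \<squnion> u) \<sqinter> v = u" using assms xy by (simp add: join_absorb meet_absorb)
  moreover have "(y \<squnion> u) \<sqinter> v = v"
  proof -
    have "u \<sqsubseteq> y" using assms xy by (meson le_trans)
    then show ?thesis
      using assms xy by (simp add: join_absorb meet_absorb join_comm[of L y] meet_comm[of L y])
  qed
  ultimately show ?thesis by simp
qed

text \<open>The meet and the join of a related pair are both related to \<open>y\<close>, and they coincide only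
  when \<open>x = y\<close>.\<close>

lemma congruence_comparable_pair:
  assumes "lattice_congruence L \<theta>" "(x, y) \<in> \<theta>" "x \<noteq> y"
  shows "\<exists>u v. (u, v) \<in> \<theta> \<and> u \<sqsubseteq> v \<and> u \<noteq> v"
proof (intro exI conjI)
  note xy = congruence_closed[OF assms(1,2)]
  have "(x \<sqinter> y, y \<sqinter> y) \<in> \<theta>" "(y \<squnion> y, x \<squnion> y) \<in> \<theta>"
    using assms xy by (auto intro: congruence_join congruence_meet congruence_refl congruence_sym)
  then show "(x \<sqinter> y, x \<squnion> y) \<in> \<theta>"
    using xy assms(1) by (auto simp: join_absorb meet_absorb intro: congruence_trans)
  show le: "x \<sqinter> y \<sqsubseteq> x \<squnion> y"
    using xy by (meson join_closed join_left le_trans meet_closed meet_left)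
  show "x \<sqinter> y \<noteq> x \<squnion> y"
  proof
    assume eq: "x \<sqinter> y = x \<squnion> y"
    have "x \<sqsubseteq> y" "y \<sqsubseteq> x"
      using xy join_left[of x y] join_right[of x y] meet_left[of x y] meet_right[of x y]
        le_trans[of x "x \<squnion> y" y] le_trans[of y "x \<squnion> y" x] by (simp_all add: eq)
    then show False using xy assms(3) le_antisym by blast
  qed
qed

lemma full_congruence: "lattice_congruence L (carrier L \<times> carrier L)"
  by (auto simp: lattice_congruence_def equiv_def refl_on_def intro: symI transI)

lemma identity_congruence: "lattice_congruence L (Id_on (carrier L))"
  by (auto simp: lattice_congruence_def equiv_def refl_on_def intro: symI transI)

section \<open>Congruences of \<open>D L\<close>\<close>

text \<open>Meeting \<open>c \<theta> b\<close> with either new element for \<open>[a, b]\<close> gives \<open>a \<theta> New s a b\<close>, as \<open>c\<close> is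
  a complement of \<open>New s a b\<close>; the join of these two relations is \<open>a \<theta> b\<close>.\<close>

lemma congruence_D_descend:
  assumes cong: "lattice_congruence (D L) \<theta>" and rel: "(Old c, Old b) \<in> \<theta>"
    and c: "a \<in> carrier L" "b \<in> carrier L" "c \<in> carrier L" "a \<sqsubset> c" "c \<sqsubset> b"
  shows "(Old a, Old b) \<in> \<theta>"
proof -
  interpret D: lattice "D L" by (rule lattice_D)
  have new: "New s a b \<in> carrier (D L)" for s
    using c by (auto simp: New_in_D)
  have "(Old a, New s a b) \<in> \<theta>" for s
  proof -
    have "(New s a b \<sqinter>\<^bsub>D L\<^esub> Old c, New s a b \<sqinter>\<^bsub>D L\<^esub> Old b) \<in> \<theta>"
      using new cong rel by (intro D.congruence_meet D.congruence_refl)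
    then show ?thesis
      using c new by (simp add: New_inside_complementary D.meet_absorb D_le_iff_ends)
  qed
  from D.congruence_join[OF cong this this, of Lft Rgt] show ?thesis
    using c new by (simp add: New_pair_complementary D.join_absorb)
qed

text \<open>Dual to the previous lemma.\<close>

lemma congruence_D_ascend:
  assumes cong: "lattice_congruence (D L) \<theta>" and rel: "(Old a, Old c) \<in> \<theta>"
    and c: "a \<in> carrier L" "b \<in> carrier L" "c \<in> carrier L" "a \<sqsubset> c" "c \<sqsubset> b"
  shows "(Old a, Old b) \<in> \<theta>"
proof -
  interpret D: lattice "D L" by (rule lattice_D)
  have new: "New s a b \<in> carrier (D L)" for s
    using c by (auto simp: New_in_D)
  have "(New s a b, Old b) \<in> \<theta>" for s
  proof -
    have "(Old a \<squnion>\<^bsub>D L\<^esub> New s a b, Old c \<squnion>\<^bsub>D L\<^esub> New s a b) \<in> \<theta>"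
      using new cong rel by (intro D.congruence_join D.congruence_refl)
    then show ?thesis
      using c new
      by (simp add: New_inside_complementary D.join_absorb D_le_iff_ends join_comm[of "D L" "Old c"])
  qed
  from D.congruence_meet[OF cong this this, of Lft Rgt] show ?thesis
    using c new by (simp add: New_pair_complementary D.meet_absorb)
qed

text \<open>Since \<open>x < y\<close>, the elements \<open>x \<le> upper_end x \<le> lower_end y \<le> y\<close> are all related. Either
  the middle two already differ, or one of the outer inequalities is strict; in that case the outer
  element is new, and an old element \<open>c\<close> strictly between its ends, being its complement, turns the
  pair (new element, one of its ends) into the pair of \<open>c\<close> and the other end.\<close>

lemma congruence_D_Old_pair:
  assumes cong: "lattice_congruence (D L) \<theta>"
    and xy: "(x, y) \<in> \<theta>" "x \<sqsubseteq>\<^bsub>D L\<^esub> y" "x \<noteq> y"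
  obtains p q where "p \<in> carrier L" "q \<in> carrier L" "p \<sqsubset> q" "(Old p, Old q) \<in> \<theta>"
proof -
  interpret D: lattice "D L" by (rule lattice_D)
  have D: "x \<in> carrier (D L)" "y \<in> carrier (D L)"
    using D.congruence_closed[OF cong xy(1)] by auto
  have le: "upper_end x \<sqsubseteq> lower_end y"
    using xy D by (simp add: D_le_iff_ends)
  have sub: "(u, v) \<in> \<theta>"
    if "u \<in> carrier (D L)" "v \<in> carrier (D L)" "x \<sqsubseteq>\<^bsub>D L\<^esub> u" "u \<sqsubseteq>\<^bsub>D L\<^esub> v" "v \<sqsubseteq>\<^bsub>D L\<^esub> y" for u v
    using D.congruence_convex[OF cong xy(1) that] .
  show thesis
  proof (cases "upper_end x = lower_end y")
    case False
    have "(Old (upper_end x), Old (lower_end y)) \<in> \<theta>"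
      using D le by (intro sub) (auto simp: D_le_iff_ends)
    moreover have "upper_end x \<sqsubset> lower_end y" using le False by (simp add: lless_eq)
    ultimately show thesis using that D by (meson ends_closed)
  next
    case True
    show thesis
    proof (cases y)
      case (New s a b)
      then obtain c where c: "a \<in> carrier L" "b \<in> carrier L" "c \<in> carrier L" "a \<sqsubset> c" "c \<sqsubset> b"
        using D by (auto simp: New_in_D)
      have "(Old a, New s a b) \<in> \<theta>"
        using D le New True c by (intro sub) (auto simp: D_le_iff_ends)
      then have "(Old a \<squnion>\<^bsub>D L\<^esub> Old c, New s a b \<squnion>\<^bsub>D L\<^esub> Old c) \<in> \<theta>"
        using c cong by (intro D.congruence_join D.congruence_refl) auto
      then have "(Old c, Old b) \<in> \<theta>"
        using c by (simp add: New_inside_complementary D.join_absorb D_le_iff_ends lless_eq)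
      then show thesis using that c by blast
    next
      case (Old e)
      then obtain s a where New: "x = New s a e"
        using True xy(3) by (cases x) auto
      then obtain c where c: "a \<in> carrier L" "e \<in> carrier L" "c \<in> carrier L" "a \<sqsubset> c" "c \<sqsubset> e"
        using D by (auto simp: New_in_D)
      have "(New s a e \<sqinter>\<^bsub>D L\<^esub> Old c, Old e \<sqinter>\<^bsub>D L\<^esub> Old c) \<in> \<theta>"
        using c cong xy Old New by (intro D.congruence_meet D.congruence_refl) auto
      then have "(Old a, Old c) \<in> \<theta>"
        using c by (simp add: New_inside_complementary D.meet_absorb D_le_iff_ends lless_eq
            meet_comm[of "D L" "Old e"])
      then show thesis using that c by blast
    qed
  qed
qed

end

context bounded_lattice
begin

lemma D_bottom_top:
  assumes "x \<in> carrier (D L)"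
  shows "Old \<bottom> \<sqsubseteq>\<^bsub>D L\<^esub> x" "x \<sqsubseteq>\<^bsub>D L\<^esub> Old \<top>"
  using assms by (simp_all add: D_le_iff_ends)

lemma bounded_lattice_D: "bounded_lattice (D L)"
proof -
  interpret D: lattice "D L" by (rule lattice_D)
  show ?thesis
  proof
    show "\<exists>x. least (D L) x (carrier (D L))"
      by (intro exI[of _ "Old \<bottom>"]) (simp add: least_def D_bottom_top)
    show "\<exists>x. greatest (D L) x (carrier (D L))"
      by (intro exI[of _ "Old \<top>"]) (simp add: greatest_def D_bottom_top)
  qed
qed

text \<open>The lower member is moved to \<open>\<bottom>\<close> before the upper one is moved to \<open>\<top>\<close>; each move has an
  interval with an interior point at its disposal unless there is nothing to move.\<close>

lemma congruence_D_bottom_top: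
  assumes cong: "lattice_congruence (D L) \<theta>" and rel: "(Old p, Old q) \<in> \<theta>"
    and pq: "p \<in> carrier L" "q \<in> carrier L" "p \<sqsubset> q"
  shows "(Old \<bottom>, Old \<top>) \<in> \<theta>"
proof -
  have "(Old \<bottom>, Old q) \<in> \<theta>"
  proof (cases "p = \<bottom>")
    case False
    then have "\<bottom> \<sqsubset> p" using pq by (auto simp: lless_eq)
    then show ?thesis using congruence_D_descend[OF cong rel] pq by simp
  qed (use rel in simp)
  show ?thesis
  proof (cases "q = \<top>")
    case False
    then have "q \<sqsubset> \<top>" using pq by (auto simp: lless_eq)
    moreover have "\<bottom> \<sqsubset> q"
      using pq by (metis bottom_closed bottom_lower le_antisym lless_eq)
    ultimately show ?thesis
      using congruence_D_ascend[OF cong \<open>(Old \<bottom>, Old q) \<in> \<theta>\<close>] pq by simp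
  qed (use \<open>(Old \<bottom>, Old q) \<in> \<theta>\<close> in simp)
qed

lemma congruence_D_trivial:
  assumes cong: "lattice_congruence (D L) \<theta>"
  shows "\<theta> = Id_on (carrier (D L)) \<or> \<theta> = carrier (D L) \<times> carrier (D L)"
proof -
  interpret D: lattice "D L" by (rule lattice_D)
  show ?thesis
  proof (cases "\<exists>x y. (x, y) \<in> \<theta> \<and> x \<noteq> y")
    case True
    then obtain u v where "(u, v) \<in> \<theta>" "u \<sqsubseteq>\<^bsub>D L\<^esub> v" "u \<noteq> v"
      using D.congruence_comparable_pair[OF cong] by blast
    then obtain p q where "p \<in> carrier L" "q \<in> carrier L" "p \<sqsubset> q" "(Old p, Old q) \<in> \<theta>"
      using congruence_D_Old_pair[OF cong] by blast
    then have bt: "(Old \<bottom>, Old \<top>) \<in> \<theta>"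
      using congruence_D_bottom_top[OF cong] by blast
    have "(Old \<bottom>, x) \<in> \<theta>" if "x \<in> carrier (D L)" for x
      using that by (intro D.congruence_convex[OF cong bt]) (auto simp: D_bottom_top)
    then have "carrier (D L) \<times> carrier (D L) \<subseteq> \<theta>"
      using D.congruence_sym[OF cong] D.congruence_trans[OF cong] by blast
    moreover have "\<theta> \<subseteq> carrier (D L) \<times> carrier (D L)"
      using D.congruence_closed[OF cong] by auto
    ultimately show ?thesis by blast
  next
    case False
    have "(x, y) \<in> \<theta> \<longleftrightarrow> x \<in> carrier (D L) \<and> x = y" for x y
      using False D.congruence_closed[OF cong] D.congruence_refl[OF cong] by blast
    then have "\<theta> = Id_on (carrier (D L))"
      by (auto simp: Id_on_def)
    then show ?thesis ..
  qed
qed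

end

section \<open>Simplicity of \<open>D L\<close>\<close>

theorem theorem5p4:
  fixes L :: "('a, 'b) gorder_scheme"
  assumes "bounded_lattice L"
    and "\<exists>x \<in> carrier L. \<exists>y \<in> carrier L. x \<noteq> y"
  shows "bounded_lattice (D L) \<and> simple_lattice (D L)"
proof -
  interpret bounded_lattice L by fact
  interpret D: lattice "D L" by (rule lattice_D)
  obtain x y where "x \<in> carrier L" "y \<in> carrier L" "x \<noteq> y"
    using assms(2) by blast
  then have "(Old x, Old y) \<in> carrier (D L) \<times> carrier (D L) - Id_on (carrier (D L))"
    by auto
  then have "Id_on (carrier (D L)) \<noteq> carrier (D L) \<times> carrier (D L)"
    by blast
  moreover have "{\<theta>. lattice_congruence (D L) \<theta>}
      = {Id_on (carrier (D L)), carrier (D L) \<times> carrier (D L)}"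
    using congruence_D_trivial D.identity_congruence D.full_congruence by blast
  ultimately show ?thesis
    using bounded_lattice_D lattice_D by (simp add: simple_lattice_def)
qed

end
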